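(* For every integer $n\ge 21$ and all real numbers $\mu_0>0$, $\mu_1>0$ and $l\ge 1$, the method $\phi^{(6)}_1$ is more efficient than the method $\phi^{(5)}_1$; that is, $$R^{6,5}_{1,1}=\frac{\log E^{(6)}_1}{\log E^{(5)}_1}=\frac{C^{(5)}_1\,\log 6}{C^{(6)}_1\,\log 5}>1,$$ where $E^{(6)}_1=6^{1/C^{(6)}_1}$, $E^{(5)}_1=5^{1/C^{(5)}_1}$ and $$C^{(6)}_1=2n\mu_0+2n^2\mu_1+\frac n2\left(2n^2+15n-3+3l(n+1)\right),$$ $$C^{(5)}_1=2n\mu_0+2n^2\mu_1+\frac n2\left(2n^2+9n-3+3l(n+1)\right).$$
   Context: The methods solve a system $F(x)=0$ of $n$ nonlinear equations in $n$ unknowns, with $F:D\subseteq\mathbb{R}^n\to\mathbb{R}^n$. Method $\phi^{(6)}_1$ (assigned order of convergence $6$): $y^{(k)}=x^{(k)}-F'(x^{(k)})^{-1}F(x^{(k)})$, $z^{(k)}=x^{(k)}-2[F'(x^{(k)})+F'(y^{(k)})]^{-1}F(x^{(k)})$, $x^{(k+1)}=z^{(k)}-[3F'(y^{(k)})-F'(x^{(k)})]^{-1}[F'(x^{(k)})+F'(y^{(k)})]F'(x^{(k)})^{-1}F(z^{(k)})$. Method $\phi^{(5)}_1$ (assigned order of convergence $5$): the same $y^{(k)}$ and $z^{(k)}$, and $x^{(k+1)}=z^{(k)}-F'(y^{(k)})^{-1}F(z^{(k)})$. The efficiency index of a method with order $p$ and computational cost $C>0$ per iteration is $E=p^{1/C}$.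 The cost is measured in numbers of products; $\mu_0$ and $\mu_1$ are the ratios expressing, in products, the cost of one scalar evaluation of a component of $F$ and of an entry of $F'$ respectively, and one quotient is counted as $l$ products. The costs of the two methods are the quantities $C^{(6)}_1$ and $C^{(5)}_1$ given explicitly in the claim, and these together with the orders $6$ and $5$ are taken as the definition of the efficiencies. A method $\phi^{(p)}_i$ is called more efficient than $\phi^{(q)}_j$ if $R^{p,q}_{i,j}=\log E^{(p)}_i/\log E^{(q)}_j>1$, and less efficient if $R^{p,q}_{i,j}<1$. *)

theory Defs
  imports Complex_Main
begin

text \<open>
  For the comparison of efficiencies an iterative method is given by its assigned order of
  convergence and its computational cost per iteration, measured in numbers of products.
\<close>

record iterative_method =
  order :: nat
  cost :: real

definition efficiency_index :: "iterative_method \<Rightarrow> real" where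
  "efficiency_index M = real (order M) powr (1 / cost M)"

text \<open>The base of the logarithm is immaterial in this quotient.\<close>

definition efficiency_ratio :: "iterative_method \<Rightarrow> iterative_method \<Rightarrow> real" where
  "efficiency_ratio M N = ln (efficiency_index M) / ln (efficiency_index N)"

definition more_efficient :: "iterative_method \<Rightarrow> iterative_method \<Rightarrow> bool" where
  "more_efficient M N \<longleftrightarrow> efficiency_ratio M N > 1"

text \<open>
  Both methods solve \<open>F(x) = 0\<close> for \<open>n\<close> equations in \<open>n\<close> unknowns and begin with
  \<open>y = x - F'(x)\<^sup>-\<^sup>1 F(x)\<close> and \<open>z = x - 2 [F'(x) + F'(y)]\<^sup>-\<^sup>1 F(x)\<close>; the next iterate is
  \<open>z - [3 F'(y) - F'(x)]\<^sup>-\<^sup>1 [F'(x) + F'(y)] F'(x)\<^sup>-\<^sup>1 F(z)\<close> for the sixth-order method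
  \<open>phi6_1\<close>, and \<open>z - F'(y)\<^sup>-\<^sup>1 F(z)\<close> for the fifth-order method \<open>phi5_1\<close>.
  The parameters \<open>\<mu>0\<close> and \<open>\<mu>1\<close> are the costs, in products, of evaluating one component of \<open>F\<close>
  and one entry of \<open>F'\<close>; one quotient costs \<open>l\<close> products.
\<close>

definition phi6_1 :: "nat \<Rightarrow> real \<Rightarrow> real \<Rightarrow> real \<Rightarrow> iterative_method" where
  "phi6_1 n \<mu>0 \<mu>1 l =
    \<lparr>order = 6,
     cost = 2 * real n * \<mu>0 + 2 * real n ^ 2 * \<mu>1
       + real n / 2 * (2 * real n ^ 2 + 15 * real n - 3 + 3 * l * (real n + 1))\<rparr>"

definition phi5_1 :: "nat \<Rightarrow> real \<Rightarrow> real \<Rightarrow> real \<Rightarrow> iterative_method" where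
  "phi5_1 n \<mu>0 \<mu>1 l =
    \<lparr>order = 5,
     cost = 2 * real n * \<mu>0 + 2 * real n ^ 2 * \<mu>1
       + real n / 2 * (2 * real n ^ 2 + 9 * real n - 3 + 3 * l * (real n + 1))\<rparr>"

end

theory Submission
  imports Defs
begin

text \<open>
  The costs differ by \<open>3 n\<^sup>2\<close>, and for \<open>l \<ge> 1\<close> the fifth-order method costs at least
  \<open>n\<^sup>2 (n + 6)\<close>. So the costs are in ratio at most \<open>1 + 3 / (n + 6) \<le> 10 / 9\<close> once
  \<open>n \<ge> 21\<close>, and \<open>10 / 9 < ln 6 / ln 5\<close> because \<open>5\<^sup>1\<^sup>0 < 6\<^sup>9\<close>.
\<close>

lemma order_phi [simp]:
  "order (phi6_1 n \<mu>0 \<mu>1 l) = 6"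
  "order (phi5_1 n \<mu>0 \<mu>1 l) = 5"
  by (simp_all add: phi6_1_def phi5_1_def)

lemma ln_efficiency_index:
  assumes "order M > 0"
  shows "ln (efficiency_index M) = ln (real (order M)) / cost M"
  using assms by (simp add: efficiency_index_def ln_powr)

text \<open>Inside the brackets only the coefficients 15 and 9 of \<open>n\<close> differ, which
  contributes \<open>n / 2 * 6 * n\<close>.\<close>

lemma cost_phi6_1_eq:
  "cost (phi6_1 n \<mu>0 \<mu>1 l) = cost (phi5_1 n \<mu>0 \<mu>1 l) + 3 * real n ^ 2"
  by (simp add: phi6_1_def phi5_1_def algebra_simps power2_eq_square)

text \<open>The evaluation terms are nonnegative and the remaining term is nondecreasing in
  \<open>l\<close>; at \<open>l = 1\<close> the constants -3 and 3 cancel and the bracket becomes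
  \<open>2 * n^2 + 12 * n\<close>.\<close>

lemma cost_phi5_1_ge:
  assumes "\<mu>0 \<ge> 0" and "\<mu>1 \<ge> 0" and "l \<ge> 1"
  shows "cost (phi5_1 n \<mu>0 \<mu>1 l) \<ge> real n ^ 2 * (real n + 6)"
proof -
  have "3 * (real n + 1) \<le> 3 * l * (real n + 1)"
    using assms(3) by (intro mult_right_mono) auto
  then have "real n / 2 * (2 * real n ^ 2 + 9 * real n - 3 + 3 * (real n + 1)) \<le>
      real n / 2 * (2 * real n ^ 2 + 9 * real n - 3 + 3 * l * (real n + 1))"
    by (intro mult_left_mono) auto
  moreover have "real n / 2 * (2 * real n ^ 2 + 9 * real n - 3 + 3 * (real n + 1)) =
      real n ^ 2 * (real n + 6)"
    by (simp add: field_simps power2_eq_square)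
  moreover have "0 \<le> 2 * real n * \<mu>0" and "0 \<le> 2 * real n ^ 2 * \<mu>1"
    using assms by simp_all
  ultimately show ?thesis
    unfolding phi5_1_def iterative_method.simps by linarith
qed

text \<open>The margin is narrow: 9765625 < 10077696.\<close>

lemma ln_5_less_ln_6: "10 * ln (5::real) < 9 * ln 6"
proof -
  have "ln ((5::real) ^ 10) < ln (6 ^ 9)"
    by (subst ln_less_cancel_iff) simp_all
  then show ?thesis
    unfolding ln_realpow by simp
qed

theorem mainTheorem1:
  fixes n :: nat and \<mu>0 \<mu>1 l :: real
  assumes "n \<ge> 21" and "\<mu>0 > 0" and "\<mu>1 > 0" and "l \<ge> 1"
  shows "more_efficient (phi6_1 n \<mu>0 \<mu>1 l) (phi5_1 n \<mu>0 \<mu>1 l) \<and>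
    efficiency_ratio (phi6_1 n \<mu>0 \<mu>1 l) (phi5_1 n \<mu>0 \<mu>1 l) =
      ln (efficiency_index (phi6_1 n \<mu>0 \<mu>1 l)) / ln (efficiency_index (phi5_1 n \<mu>0 \<mu>1 l)) \<and>
    ln (efficiency_index (phi6_1 n \<mu>0 \<mu>1 l)) / ln (efficiency_index (phi5_1 n \<mu>0 \<mu>1 l)) =
      (cost (phi5_1 n \<mu>0 \<mu>1 l) * ln 6) / (cost (phi6_1 n \<mu>0 \<mu>1 l) * ln 5) \<and>
    (cost (phi5_1 n \<mu>0 \<mu>1 l) * ln 6) / (cost (phi6_1 n \<mu>0 \<mu>1 l) * ln 5) > 1"
proof -
  define A where "A = cost (phi5_1 n \<mu>0 \<mu>1 l)"
  define B where "B = cost (phi6_1 n \<mu>0 \<mu>1 l)"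
  \<comment> \<open>The threshold enters here: 27 = 21 + 6.\<close>
  have "real n ^ 2 * 27 \<le> real n ^ 2 * (real n + 6)"
    using assms(1) by (intro mult_left_mono) auto
  also have "\<dots> \<le> A"
    unfolding A_def using assms by (intro cost_phi5_1_ge) auto
  finally have A_ge: "27 * real n ^ 2 \<le> A"
    by simp
  have B_eq: "B = A + 3 * real n ^ 2"
    unfolding A_def B_def by (rule cost_phi6_1_eq)
  have "0 < real n ^ 2"
    using assms(1) by simp
  then have pos: "0 < A" "0 < B"
    using A_ge B_eq by linarith+
  have "9 * (B * ln 5) = (9 * B) * ln 5"
    by simp
  \<comment> \<open>\<open>9 * B = 9 * A + 27 * n^2\<close>, and \<open>A_ge\<close> absorbs the
    last term into one more \<open>A\<close>.\<close>
  also have "\<dots> \<le> (10 * A) * ln 5"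
    using A_ge B_eq by (intro mult_right_mono) auto
  also have "\<dots> = A * (10 * ln 5)"
    by simp
  also have "\<dots> < A * (9 * ln 6)"
    using pos(1) ln_5_less_ln_6 by (rule mult_strict_left_mono[rotated])
  finally have "B * ln 5 < A * ln 6"
    by simp
  then have gt: "(A * ln 6) / (B * ln 5) > 1"
    using pos by simp
  \<comment> \<open>Each logarithm is \<open>ln p / C\<close>, so dividing them inverts the ratio of
    the costs.\<close>
  have eq: "ln (efficiency_index (phi6_1 n \<mu>0 \<mu>1 l)) / ln (efficiency_index (phi5_1 n \<mu>0 \<mu>1 l)) =
      (A * ln 6) / (B * ln 5)"
    by (simp add: ln_efficiency_index A_def B_def)
  show ?thesis
    using gt eq by (simp add: more_efficient_def efficiency_ratio_def A_def B_def)
qed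

end
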